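(* There exist a complete metric space $(X,d)$, a conical bicombing $\sigma$ on $X$, and a finite subset $A\subset X$ such that the closed $\sigma$-convex hull $\sigma\text{-}\mathrm{conv}(A)$ is not compact.
   Context: Let $(X,d)$ be a metric space. A geodesic in $X$ is a map $c\colon[0,1]\to X$ with $d(c(s),c(t))=|s-t|\,d(c(0),c(1))$ for all $s,t\in[0,1]$. A (geodesic) bicombing on $X$ is a map $\sigma\colon X\times X\times[0,1]\to X$ such that for all $x,y\in X$ the path $\sigma_{xy}(t)=\sigma(x,y,t)$ is a geodesic with $\sigma_{xy}(0)=x$ and $\sigma_{xy}(1)=y$. It is called conical if $$d(\sigma_{xy}(t),\sigma_{x'y'}(t))\le(1-t)\,d(x,x')+t\,d(y,y')$$ for all $x,y,x',y'\in X$ and all $t\in[0,1]$. A pair $(X,\sigma)$ with $X$ complete and $\sigma$ a conical bicombing on $X$ is called a space of generalized non-positive curvature. A subset $C\subset X$ is $\sigma$-convex if $\sigma_{xy}([0,1])\subset C$ for all $x,y\in C$. For $A\subset X$, the closed $\sigma$-convex hull $\sigma\text{-}\mathrm{conv}(A)$ is the intersection of all closed $\sigma$-convex subsets of $X$ containing $A$. *)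

theory Defs
  imports "HOL-Analysis.Analysis"
begin

context Metric_space
begin

text \<open>Geodesics have constant, not necessarily unit, speed.
  Values of paths and bicombings outside the unit interval, or at points outside the carrier
  \<open>M\<close>, are unconstrained.\<close>

definition geodesic :: "(real \<Rightarrow> 'a) \<Rightarrow> bool" where
  "geodesic c \<longleftrightarrow> c \<in> {0..1} \<rightarrow> M \<and>
     (\<forall>s\<in>{0..1}. \<forall>t\<in>{0..1}. d (c s) (c t) = \<bar>s - t\<bar> * d (c 0) (c 1))"

definition bicombing :: "('a \<Rightarrow> 'a \<Rightarrow> real \<Rightarrow> 'a) \<Rightarrow> bool" where
  "bicombing \<sigma> \<longleftrightarrow>
     (\<forall>x\<in>M. \<forall>y\<in>M. geodesic (\<sigma> x y) \<and> \<sigma> x y 0 = x \<and> \<sigma> x y 1 = y)"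

definition conical_bicombing :: "('a \<Rightarrow> 'a \<Rightarrow> real \<Rightarrow> 'a) \<Rightarrow> bool" where
  "conical_bicombing \<sigma> \<longleftrightarrow> bicombing \<sigma> \<and>
     (\<forall>x\<in>M. \<forall>y\<in>M. \<forall>x'\<in>M. \<forall>y'\<in>M. \<forall>t\<in>{0..1}.
        d (\<sigma> x y t) (\<sigma> x' y' t) \<le> (1 - t) * d x x' + t * d y y')"

definition sigma_convex :: "('a \<Rightarrow> 'a \<Rightarrow> real \<Rightarrow> 'a) \<Rightarrow> 'a set \<Rightarrow> bool" where
  "sigma_convex \<sigma> C \<longleftrightarrow> C \<subseteq> M \<and> (\<forall>x\<in>C. \<forall>y\<in>C. \<sigma> x y ` {0..1} \<subseteq> C)"

definition closed_sigma_hull :: "('a \<Rightarrow> 'a \<Rightarrow> real \<Rightarrow> 'a) \<Rightarrow> 'a set \<Rightarrow> 'a set" where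
  "closed_sigma_hull \<sigma> A = \<Inter> {C. closedin mtopology C \<and> sigma_convex \<sigma> C \<and> A \<subseteq> C}"

end

end

theory Submission
  imports Defs "HOL-Probability.Discrete_Topology"
begin

text \<open>On binary trees, the largest pseudometric for which joining two trees is an idempotent
  conical midpoint map, and distinct leaves have distance 1, is given by an explicit recursion: the
  distance of two trees is the least of the averages obtained by splitting the first, the second or
  both of them. Its completion carries a conical midpoint map, and bisection turns that
  into a conical bicombing.

  To see that finitely many leaves do not have a compact hull, regard as letters \<open>N\<close> trees
  such that any subtree of one of them has distance less than \<open>c\<close> to at most one of them. Two perfect trees with \<open>R\<close> distinct letters each that share
  at most one letter satisfy the same with \<open>c(1 - 1/R)\<close> in place of \<open>c\<close>, as for the Wasserstein distance of the
  uniform measures on their letters, and for \<open>N = 32R\<^sup>3\<close> there are more than \<open>N\<close> such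
  trees: lines in a grid. Iterating with
  \<open>R = 4, 8, 16, \<dots>\<close> keeps the distances above \<open>1/2\<close> while the number of trees is unbounded.\<close>

section \<open>The free conical midpoint algebra\<close>

datatype tree = Leaf nat | Node tree tree

instance tree :: countable
  by countable_datatype

text \<open>Each alternative in the minimum is an upper bound forced by the conical inequality.
  Splitting only one of two trees is justified by idempotence, which lets the other tree
  \<open>x\<close> be read as \<open>Node x x\<close>.\<close>

fun tdist :: "tree \<Rightarrow> tree \<Rightarrow> real" where
  "tdist (Leaf i) (Leaf j) = (if i = j then 0 else 1)"
| "tdist (Leaf i) (Node r s) = (tdist (Leaf i) r + tdist (Leaf i) s) / 2"
| "tdist (Node p q) (Leaf j) = (tdist p (Leaf j) + tdist q (Leaf j)) / 2"
| "tdist (Node p q) (Node r s) =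
     min (min ((tdist p (Node r s) + tdist q (Node r s)) / 2)
              ((tdist (Node p q) r + tdist (Node p q) s) / 2))
         ((tdist p r + tdist q s) / 2)"

lemma tdist_nonneg: "0 \<le> tdist x y"
  by (induction x y rule: tdist.induct) auto

lemma tdist_le_1: "tdist x y \<le> 1"
  by (induction x y rule: tdist.induct) (auto simp: min_le_iff_disj)

lemma tdist_commute: "tdist x y = tdist y x"
  by (induction x y rule: tdist.induct) (auto simp: add.commute min.commute min.left_commute)

lemma tdist_Node_left: "tdist (Node p q) y \<le> (tdist p y + tdist q y) / 2"
  by (cases y) (simp_all del: le_divide_eq_numeral1 add: min.coboundedI1)

lemma tdist_Node_right: "tdist x (Node r s) \<le> (tdist x r + tdist x s) / 2"
  by (cases x) (simp_all del: le_divide_eq_numeral1 add: min.coboundedI1)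

lemma tdist_Node_Node: "tdist (Node p q) (Node r s) \<le> (tdist p r + tdist q s) / 2"
  by (simp del: le_divide_eq_numeral1)

declare tdist.simps(4) [simp del]

lemma tdist_self [simp]: "tdist x x = 0"
proof (induction x)
  case (Node p q)
  then show ?case
    using tdist_Node_Node[of p q p q] tdist_nonneg[of "Node p q" "Node p q"]
    by simp
qed simp

text \<open>The minimum is attained. Lower bounds on \<open>tdist\<close> are proved through this
  split, upper bounds through the three inequalities above.\<close>

lemma tdist_cases:
  obtains (leaves) i j where "x = Leaf i" "y = Leaf j"
  | (left) p q where "x = Node p q" "tdist x y = (tdist p y + tdist q y) / 2"
  | (right) r s where "y = Node r s" "tdist x y = (tdist x r + tdist x s) / 2"
  | (parallel) p q r s where "x = Node p q" "y = Node r s" "tdist x y = (tdist p r + tdist q s) / 2"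
proof (cases x)
  case (Leaf i)
  then show ?thesis using leaves right by (cases y) auto
next
  case x: (Node p q)
  show ?thesis
  proof (cases y)
    case (Leaf j)
    then show ?thesis using x left by simp
  next
    case y: (Node r s)
    have "tdist x y = (tdist p y + tdist q y) / 2 \<or> tdist x y = (tdist x r + tdist x s) / 2 \<or>
        tdist x y = (tdist p r + tdist q s) / 2"
      unfolding x y by (simp add: tdist.simps(4) min_def)
    then show ?thesis using x y left right parallel by blast
  qed
qed

text \<open>Optimal splits for \<open>x, y\<close> and for \<open>y, z\<close> are composed. A split
  of \<open>x\<close> alone or of \<open>z\<close> alone is applied directly to the pair
  \<open>x, z\<close>. Otherwise both splits divide the middle tree \<open>y\<close>, and its two
  halves are matched; unless all trees are leaves, the induction applies to the smaller
  pieces.\<close>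

lemma tdist_triangle: "tdist x z \<le> tdist x y + tdist y z"
proof (induction "size x + size y + size z" arbitrary: x y z rule: less_induct)
  case less
  note IH = less
  show ?case
  proof (cases x y rule: tdist_cases)
    case xy: (left p q)
    have "tdist p z \<le> tdist p y + tdist y z" "tdist q z \<le> tdist q y + tdist y z"
      by (rule IH; simp add: xy(1))+
    then show ?thesis using tdist_Node_left[of p q z] xy by simp
  next
    case xy: (leaves i j)
    show ?thesis
    proof (cases y z rule: tdist_cases)
      case yz: (right t u)
      have "tdist x t \<le> tdist x y + tdist y t" "tdist x u \<le> tdist x y + tdist y u"
        by (rule IH; simp add: yz(1))+
      then show ?thesis using tdist_Node_right[of x t u] yz by simp
    qed (use xy in auto)
  next
    case xy: (right r s)
    show ?thesis
    proof (cases y z rule: tdist_cases)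
      case yz: (right t u)
      have "tdist x t \<le> tdist x y + tdist y t" "tdist x u \<le> tdist x y + tdist y u"
        by (rule IH; simp add: yz(1))+
      then show ?thesis using tdist_Node_right[of x t u] yz by simp
    next
      case yz: (left r' s')
      have "tdist x z \<le> tdist x r + tdist r z" "tdist x z \<le> tdist x s + tdist s z"
        by (rule IH; simp add: xy(1))+
      then show ?thesis using xy yz by simp
    next
      case yz: (parallel r' s' t u)
      have "tdist x t \<le> tdist x r + tdist r t" "tdist x u \<le> tdist x s + tdist s u"
        by (rule IH; simp add: xy(1) yz(2))+
      then show ?thesis using tdist_Node_right[of x t u] xy yz by simp
    qed (use xy in auto)
  next
    case xy: (parallel p q r s)
    show ?thesis
    proof (cases y z rule: tdist_cases)
      case yz: (right t u)
      have "tdist x t \<le> tdist x y + tdist y t" "tdist x u \<le> tdist x y + tdist y u"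
        by (rule IH; simp add: yz(1))+
      then show ?thesis using tdist_Node_right[of x t u] yz by simp
    next
      case yz: (left r' s')
      have "tdist p z \<le> tdist p r + tdist r z" "tdist q z \<le> tdist q s + tdist s z"
        by (rule IH; simp add: xy(1,2))+
      then show ?thesis using tdist_Node_left[of p q z] xy yz by simp
    next
      case yz: (parallel r' s' t u)
      have "tdist p t \<le> tdist p r + tdist r t" "tdist q u \<le> tdist q s + tdist s u"
        by (rule IH; simp add: xy(1,2) yz(2))+
      then show ?thesis using tdist_Node_Node[of p q t u] xy yz by simp
    qed (use xy in auto)
  qed
qed

section \<open>Uniformly separated trees\<close>

text \<open>The mass of \<open>B\<close> under the distribution that gives a leaf at depth
  \<open>k\<close> the mass \<open>1 / 2 ^ k\<close>.\<close>

fun weight :: "nat set \<Rightarrow> tree \<Rightarrow> real" where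
  "weight B (Leaf i) = of_bool (i \<in> B)"
| "weight B (Node p q) = (weight B p + weight B q) / 2"

fun labels :: "tree \<Rightarrow> nat set" where
  "labels (Leaf i) = {i}"
| "labels (Node p q) = labels p \<union> labels q"

fun subst :: "(nat \<Rightarrow> tree) \<Rightarrow> tree \<Rightarrow> tree" where
  "subst s (Leaf i) = s i"
| "subst s (Node p q) = Node (subst s p) (subst s q)"

fun subtrees :: "tree \<Rightarrow> tree set" where
  "subtrees (Leaf i) = {Leaf i}"
| "subtrees (Node p q) = insert (Node p q) (subtrees p \<union> subtrees q)"

lemma weight_nonneg: "0 \<le> weight B w"
  by (induction w) auto

lemma weight_le_1: "weight B w \<le> 1"
  by (induction w) auto

lemma weight_mono: "B \<subseteq> C \<Longrightarrow> weight B w \<le> weight C w"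
  by (induction w) auto

lemma weight_disjoint: "B \<inter> C = {} \<Longrightarrow> weight B w + weight C w \<le> 1"
  by (induction w) (auto simp: field_simps)

lemma weight_empty [simp]: "weight {} w = 0"
  by (induction w) auto

lemma weight_eq_1: "labels w \<subseteq> B \<Longrightarrow> weight B w = 1"
  by (induction w) auto

lemma subtrees_self: "w \<in> subtrees w"
  by (cases w) auto

lemma subtrees_labels: "v \<in> subtrees w \<Longrightarrow> labels v \<subseteq> labels w"
  by (induction w) auto

lemma subtrees_Node: "Node p q \<in> subtrees w \<Longrightarrow> p \<in> subtrees w \<and> q \<in> subtrees w"
  using subtrees_self by (induction w) auto

lemma labels_subst: "labels (subst s w) = (\<Union>i\<in>labels w. labels (s i))"
  by (induction w) auto

text \<open>A pair \<^term>\<open>(x, ow)\<close> in \<^term>\<open>D\<close> assigns to a subtree \<^term>\<open>x\<close> the only index, if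
  any, of a tree in the family to which \<^term>\<open>x\<close> may be close. The assignment is a relation
  because a tree may occur in several roles.\<close>

definition separated_family ::
    "(nat \<Rightarrow> tree) \<Rightarrow> nat \<Rightarrow> real \<Rightarrow> (tree \<times> nat option) set \<Rightarrow> bool" where
  "separated_family s N c D \<longleftrightarrow>
     (\<forall>i<N. (s i, Some i) \<in> D) \<and>
     (\<forall>p q ow. (Node p q, ow) \<in> D \<longrightarrow>
        (\<exists>ow'\<in>{None, ow}. (p, ow') \<in> D) \<and> (\<exists>ow'\<in>{None, ow}. (q, ow') \<in> D)) \<and>
     (\<forall>x ow i. (x, ow) \<in> D \<longrightarrow> i < N \<longrightarrow> ow \<noteq> Some i \<longrightarrow> c \<le> tdist x (s i))"

text \<open>A child of \<open>x\<close> may have no owner even if \<open>x\<close> has one. Then no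
  letter is exempt from the lower bound, so the bound for the child is only stronger.\<close>

lemma separated_family_child_bound:
  assumes "\<exists>ow'\<in>{None, ow}. (p, ow') \<in> D"
    and "\<And>ow'. (p, ow') \<in> D \<Longrightarrow> c * (1 - weight {i. ow' = Some i} w) \<le> d"
    and "0 \<le> c"
  shows "c * (1 - weight {i. ow = Some i} w) \<le> (d::real)"
proof -
  obtain ow' where ow': "ow' \<in> {None, ow}" "(p, ow') \<in> D" using assms(1) by blast
  have "weight {i. ow' = Some i} w \<le> weight {i. ow = Some i} w"
    by (rule weight_mono) (use ow' in auto)
  then have "c * (1 - weight {i. ow = Some i} w) \<le> c * (1 - weight {i. ow' = Some i} w)"
    using assms(3) by (intro mult_left_mono) auto
  then show ?thesis using assms(2)[OF ow'(2)] by linarith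
qed

text \<open>Only the owner of \<open>x\<close> is a cheap letter; every other letter costs at least
  \<open>c\<close>. The bound for \<open>w\<close> is the average of those for its two children, so
  it survives a split of \<open>w\<close>; when \<open>x\<close> is split, its children inherit the
  bound by the previous lemma.\<close>

lemma separated_family_tdist_subst:
  assumes fam: "separated_family s N c D" and c: "0 \<le> c"
    and "(x, ow) \<in> D" and "labels w \<subseteq> {..<N}"
  shows "c * (1 - weight {i. ow = Some i} w) \<le> tdist x (subst s w)"
  using assms(3,4)
proof (induction "size x + size w" arbitrary: x ow w rule: less_induct)
  case less
  note IH = less(1)
  have child: "\<exists>ow'\<in>{None, ow}. (p, ow') \<in> D" "\<exists>ow'\<in>{None, ow}. (q, ow') \<in> D"
    if "x = Node p q" for p q
    using fam that less(2) unfolding separated_family_def by blast+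
  show ?case
  proof (cases w)
    case (Leaf i)
    then have "ow \<noteq> Some i \<Longrightarrow> c \<le> tdist x (s i)"
      using fam less(2,3) unfolding separated_family_def by auto
    then show ?thesis using Leaf tdist_nonneg[of x "s i"] by (cases "ow = Some i") auto
  next
    case w: (Node w1 w2)
    have l: "labels w1 \<subseteq> {..<N}" "labels w2 \<subseteq> {..<N}" using less(3) w by auto
    let ?c = "\<lambda>w. c * (1 - weight {i. ow = Some i} w)"
    have avg: "?c w = (?c w1 + ?c w2) / 2" using w by (simp add: field_simps)
    show ?thesis
    proof (cases x "subst s w" rule: tdist_cases)
      case (left p q)
      have "?c w \<le> tdist p (subst s w)" "?c w \<le> tdist q (subst s w)"
        by (rule separated_family_child_bound[OF child(1)[OF left(1)] _ c]
                 separated_family_child_bound[OF child(2)[OF left(1)] _ c],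
            rule IH; use left less(3) in simp)+
      then show ?thesis using left(2) by argo
    next
      case (right r t)
      have "?c w1 \<le> tdist x (subst s w1)" "?c w2 \<le> tdist x (subst s w2)"
        by (rule IH; use w l less(2) in simp)+
      then show ?thesis using right avg w by simp
    next
      case (parallel p q r t)
      have "?c w1 \<le> tdist p (subst s w1)" "?c w2 \<le> tdist q (subst s w2)"
        by (rule separated_family_child_bound[OF child(1)[OF parallel(1)] _ c]
                 separated_family_child_bound[OF child(2)[OF parallel(1)] _ c],
            rule IH; use parallel w l in simp)+
      then show ?thesis using parallel avg w by simp
    qed (use w in auto)
  qed
qed

text \<open>This is the easy half of transport duality: a test set \<open>B\<close> bounds the cost
  from below by the difference of its masses. The bound is affine in both words and so survives
  every split. Once a word is a single letter, a split may enter that letter, and the one-sided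
  bound for its owner takes over.\<close>

lemma separated_family_subst_subst:
  assumes fam: "separated_family s N c D" and c: "0 \<le> c"
    and "labels v \<subseteq> {..<N}" "labels w \<subseteq> {..<N}"
  shows "c * (weight B v - weight B w) \<le> tdist (subst s v) (subst s w)"
  using assms(3,4)
proof (induction "size v + size w" arbitrary: v w rule: less_induct)
  case less
  note IH = less(1)
  have point: "c * (1 - weight {i} u) \<le> tdist (s i) (subst s u)"
    if "i < N" "labels u \<subseteq> {..<N}" for i u
    using separated_family_tdist_subst[OF fam c _ that(2), of "s i" "Some i"] that(1) fam
    by (auto simp: separated_family_def)
  have single: "{i. Some j = Some i} = {j}" for j :: nat by auto
  show ?case
  proof (cases v)
    case (Leaf i)
    \<comment> \<open>If \<open>i\<close> lies in \<open>B\<close>, its mass in \<open>w\<close> is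
      at most that of \<open>B\<close>; otherwise \<open>B\<close> has mass 0 in the leaf
      \<open>v\<close>.\<close>
    have "weight B v - weight B w \<le> 1 - weight {i} w"
      using weight_mono[of "{i}" B w] weight_le_1[of "{i}" w] weight_nonneg[of B w] Leaf by auto
    then have "c * (weight B v - weight B w) \<le> c * (1 - weight {i} w)"
      using c by (rule mult_left_mono)
    then show ?thesis using point[of i w] less(2,3) Leaf by auto
  next
    case v: (Node v1 v2)
    show ?thesis
    proof (cases w)
      case (Leaf i)
      \<comment> \<open>If \<open>i\<close> lies outside \<open>B\<close>, the masses of
        \<open>B\<close> and \<open>{i}\<close> in \<open>v\<close> sum to at most 1; otherwise the
        left side is at most 0.\<close>
      have "weight B v - weight B w \<le> 1 - weight {i} v"
        using weight_disjoint[of "{i}" B v] weight_le_1[of "{i}" v] weight_le_1[of B v] Leaf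
        by (cases "i \<in> B") auto
      then have "c * (weight B v - weight B w) \<le> c * (1 - weight {i} v)"
        using c by (rule mult_left_mono)
      then show ?thesis using point[of i v] less(2,3) Leaf by (auto simp: tdist_commute)
    next
      case w: (Node w1 w2)
      have l: "labels v1 \<subseteq> {..<N}" "labels v2 \<subseteq> {..<N}" "labels w1 \<subseteq> {..<N}" "labels w2 \<subseteq> {..<N}"
        using less(2,3) v w by auto
      let ?c = "\<lambda>v w. c * (weight B v - weight B w)"
      have avg: "?c v w = (?c v1 w + ?c v2 w) / 2" "?c v w = (?c v w1 + ?c v w2) / 2"
        "?c v w = (?c v1 w1 + ?c v2 w2) / 2" using v w by (simp_all add: field_simps)
      have "?c v1 w \<le> tdist (subst s v1) (subst s w)" "?c v2 w \<le> tdist (subst s v2) (subst s w)"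
        "?c v w1 \<le> tdist (subst s v) (subst s w1)" "?c v w2 \<le> tdist (subst s v) (subst s w2)"
        "?c v1 w1 \<le> tdist (subst s v1) (subst s w1)" "?c v2 w2 \<le> tdist (subst s v2) (subst s w2)"
        by (rule IH; use v w l less(2,3) in simp)+
      then show ?thesis
        by (cases "subst s v" "subst s w" rule: tdist_cases) (use v w avg in auto)
    qed
  qed
qed

text \<open>One round of the iteration: the trees of the family become letters of the words
  \<open>W k\<close>. Small single-letter masses handle subtrees inside a letter, small overlaps
  handle subtrees composed of whole letters.\<close>

lemma separated_family_step:
  assumes fam: "separated_family s N c D" and c: "0 \<le> c"
    and lab: "\<And>k. k < N' \<Longrightarrow> labels (W k) \<subseteq> {..<N}"
    and single: "\<And>k i. k < N' \<Longrightarrow> weight {i} (W k) \<le> \<eta>"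
    and pair: "\<And>k l. k < N' \<Longrightarrow> l < N' \<Longrightarrow> k \<noteq> l \<Longrightarrow> weight (labels (W k)) (W l) \<le> \<eta>"
    and eta: "0 \<le> \<eta>"
  shows "\<exists>D'. separated_family (\<lambda>k. subst s (W k)) N' (c * (1 - \<eta>)) D'"
proof -
  \<comment> \<open>Subtrees from the old family lose their owner, since one letter may occur in
    several words. The subtrees of \<open>W k\<close>, after substitution, are owned by
    \<open>k\<close>.\<close>
  define D' where "D' = {(x, None) | x ow. (x, ow) \<in> D} \<union>
    {(subst s v, Some k) | v k. k < N' \<and> v \<in> subtrees (W k)}"
  have D'_None: "(x, None) \<in> D'" if "(x, ow) \<in> D" for x ow
    using that unfolding D'_def by blast
  have D'_Some: "(subst s v, Some k) \<in> D'" if "k < N'" "v \<in> subtrees (W k)" for v k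
    using that unfolding D'_def by blast
  have D_child: "\<exists>ow. (p, ow) \<in> D" "\<exists>ow. (q, ow) \<in> D" if "(Node p q, ow) \<in> D" for p q ow
    using fam that unfolding separated_family_def by blast+
  have child: "(\<exists>ow'\<in>{None, ow}. (p, ow') \<in> D') \<and> (\<exists>ow'\<in>{None, ow}. (q, ow') \<in> D')"
    if "(Node p q, ow) \<in> D'" for p q ow
  proof -
    consider ow' where "(Node p q, ow') \<in> D"
      | v k where "Node p q = subst s v" "ow = Some k" "k < N'" "v \<in> subtrees (W k)"
      using \<open>(Node p q, ow) \<in> D'\<close> unfolding D'_def by blast
    then show ?thesis
    proof cases
      case 1
      then show ?thesis using D_child[OF 1] D'_None by blast
    next
      case (2 v k)
      show ?thesis
      proof (cases v)
        case (Leaf i)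
        \<comment> \<open>Here the descent enters the letter \<open>s i\<close>, whose children
          belong to the old relation and become unowned.\<close>
        then have "i < N" using lab[OF 2(3)] subtrees_labels[OF 2(4)] by auto
        then have "(Node p q, Some i) \<in> D" using fam 2(1) Leaf
          unfolding separated_family_def by auto
        then show ?thesis using D_child D'_None by blast
      next
        case (Node v1 v2)
        then have "v1 \<in> subtrees (W k)" "v2 \<in> subtrees (W k)"
          using subtrees_Node 2(4) by blast+
        then show ?thesis using D'_Some[OF 2(3)] 2(1,2) Node by auto
      qed
    qed
  qed
  have far: "c * (1 - \<eta>) \<le> tdist x (subst s (W l))"
    if D': "(x, ow) \<in> D'" and l: "l < N'" and ow: "ow \<noteq> Some l" for x ow l
  proof -
    consider ow' where "(x, ow') \<in> D"
      | v k where "x = subst s v" "ow = Some k" "k < N'" "v \<in> subtrees (W k)"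
      using D' unfolding D'_def by blast
    then show ?thesis
    proof cases
      case (1 ow')
      \<comment> \<open>An old subtree has at most one cheap letter, and that letter has mass at
        most \<eta> in \<open>W l\<close>.\<close>
      have "weight {i. ow' = Some i} (W l) \<le> \<eta>"
      proof (cases ow')
        case (Some j)
        then have "{i. ow' = Some i} = {j}" by auto
        then show ?thesis using single[OF l] by simp
      qed (use eta in simp)
      then have "c * (1 - \<eta>) \<le> c * (1 - weight {i. ow' = Some i} (W l))"
        using c by (intro mult_left_mono) auto
      also have "\<dots> \<le> tdist x (subst s (W l))"
        by (rule separated_family_tdist_subst[OF fam c 1 lab[OF l]])
      finally show ?thesis .
    next
      case (2 v k)
      have v: "labels v \<subseteq> labels (W k)" using subtrees_labels[OF 2(4)] .
      have "k \<noteq> l" using 2 ow by auto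
      \<comment> \<open>The test set is the set of letters of \<open>W k\<close>: it has full mass
        in \<open>v\<close> and mass at most \<eta> in \<open>W l\<close>.\<close>
      then have "1 - \<eta> \<le> weight (labels (W k)) v - weight (labels (W k)) (W l)"
        using pair[OF 2(3) l] weight_eq_1[OF v] by simp
      then have "c * (1 - \<eta>) \<le> c * (weight (labels (W k)) v - weight (labels (W k)) (W l))"
        using c by (rule mult_left_mono)
      also have "\<dots> \<le> tdist x (subst s (W l))"
        unfolding 2(1) using v lab[OF 2(3)] lab[OF l]
        by (intro separated_family_subst_subst[OF fam c]) auto
      finally show ?thesis .
    qed
  qed
  have "separated_family (\<lambda>k. subst s (W k)) N' (c * (1 - \<eta>)) D'"
    unfolding separated_family_def using D'_Some subtrees_self child far by blast
  then show ?thesis ..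
qed

section \<open>Perfect trees and lines in a grid\<close>

fun perfect :: "nat \<Rightarrow> (nat \<Rightarrow> nat) \<Rightarrow> tree" where
  "perfect 0 f = Leaf (f 0)"
| "perfect (Suc r) f = Node (perfect r f) (perfect r (\<lambda>i. f (i + 2 ^ r)))"

lemma lessThan_add: "{..<a + b} = {..<a} \<union> (\<lambda>i. i + a) ` {..<b::nat}"
proof -
  have "i \<in> (\<lambda>i. i + a) ` {..<b}" if "i < a + b" "\<not> i < a" for i
    using that by (intro image_eqI[of _ _ "i - a"]) auto
  then show ?thesis by auto
qed

lemma labels_perfect: "labels (perfect r f) = f ` {..<2 ^ r}"
proof (induction r arbitrary: f)
  case (Suc r)
  then show ?case by (simp add: mult_2 lessThan_add image_Un image_image)
qed auto

lemma weight_perfect: "weight B (perfect r f) = (\<Sum>i<2 ^ r. of_bool (f i \<in> B)) / 2 ^ r"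
proof (induction r arbitrary: f)
  case (Suc r)
  have "(\<Sum>i<2 ^ Suc r. of_bool (f i \<in> B) :: real) =
      (\<Sum>i<2 ^ r. of_bool (f i \<in> B)) +
      (\<Sum>i\<in>(\<lambda>i. i + 2 ^ r) ` {..<2 ^ r}. of_bool (f i \<in> B))"
    unfolding power_Suc mult_2 lessThan_add by (rule sum.union_disjoint) auto
  also have "(\<Sum>i\<in>(\<lambda>i. i + 2 ^ r) ` {..<2 ^ r}. of_bool (f i \<in> B) :: real) =
      (\<Sum>i<2 ^ r. of_bool (f (i + 2 ^ r) \<in> B))"
    by (subst sum.reindex) (auto simp: inj_on_def)
  finally show ?case using Suc by (simp add: field_simps)
qed simp

lemma weight_perfect_le:
  assumes "\<And>i j. i < 2 ^ r \<Longrightarrow> j < 2 ^ r \<Longrightarrow> f i \<in> B \<Longrightarrow> f j \<in> B \<Longrightarrow> i = j"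
  shows "weight B (perfect r f) \<le> 1 / 2 ^ r"
proof -
  have "card {i. i < 2 ^ r \<and> f i \<in> B} \<le> Suc 0"
    using assms by (intro card_le_Suc0_iff_eq[THEN iffD2]) auto
  moreover have "(\<Sum>i<2 ^ r. of_bool (f i \<in> B) :: real) = card {i. i < 2 ^ r \<and> f i \<in> B}"
    by (simp add: of_bool_def sum.If_cases Int_def)
  ultimately show ?thesis unfolding weight_perfect by (simp add: divide_right_mono)
qed

text \<open>The \<open>k\<close>-th word is the graph over \<open>{0..<R}\<close> of the line with intercept
  \<open>k mod 16R\<^sup>2\<close> and slope \<open>k div 16R\<^sup>2\<close>, where \<open>R = 2 ^ r\<close>, the point
  \<open>(i, j)\<close> being encoded by \<open>i + R * j\<close>. Two lines meet in at most one point, and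
  \<open>32(2R)\<^sup>3\<close> lines use only \<open>32R\<^sup>3\<close> points.\<close>

definition line :: "nat \<Rightarrow> nat \<Rightarrow> nat \<Rightarrow> nat" where
  "line R k i = i + R * (k mod (16 * R\<^sup>2) + k div (16 * R\<^sup>2) * i)"

text \<open>Since \<open>32 * (2 * R) ^ 3 = 16 * R * (16 * R\<^sup>2)\<close>, the slope is below
  \<open>16 * R\<close> and the intercept below \<open>16 * R\<^sup>2\<close>. Over abscissas below
  \<open>R\<close> all heights are therefore below \<open>32 * R\<^sup>2\<close>.\<close>

lemma line_less:
  assumes "i < R" "k < 32 * (2 * R) ^ 3"
  shows "line R k i < 32 * R ^ 3"
proof -
  have R: "R > 0" using assms by simp
  define a b where "a = k mod (16 * R\<^sup>2)" and "b = k div (16 * R\<^sup>2)"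
  have a: "a + 1 \<le> 16 * R\<^sup>2" unfolding a_def using R by (simp add: Suc_leI)
  have "k < 16 * R * (16 * R\<^sup>2)" using assms(2) by (simp add: power2_eq_square power3_eq_cube mult_ac)
  then have "b < 16 * R" unfolding b_def using R by (simp add: less_mult_imp_div_less)
  then have b: "b * i \<le> 16 * R * R" using assms(1) by (intro mult_mono) auto
  have "i + R * (a + b * i) < R + R * (a + b * i)" using assms by simp
  also have "\<dots> = R * (a + 1 + b * i)" by (simp add: algebra_simps)
  also have "\<dots> \<le> R * (16 * R\<^sup>2 + 16 * R * R)" using a b by (intro mult_left_mono add_mono) auto
  also have "\<dots> = 32 * R ^ 3" by (simp add: power2_eq_square power3_eq_cube algebra_simps)
  finally show ?thesis unfolding line_def a_def b_def .
qed

lemma line_eqD: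
  assumes "i < R" "i' < R" "line R k i = line R l i'"
  shows "i = i' \<and> k mod (16 * R\<^sup>2) + k div (16 * R\<^sup>2) * i = l mod (16 * R\<^sup>2) + l div (16 * R\<^sup>2) * i"
proof -
  have "line R k i mod R = i" "line R l i' mod R = i'"
    using assms(1,2) by (auto simp: line_def)
  then have "i = i'" using assms(3) by simp
  then show ?thesis using assms by (simp add: line_def)
qed

text \<open>Equal codes have equal abscissas, as these are residues modulo \<open>R\<close>. Two
  common points over distinct abscissas then force equal slopes, hence equal intercepts, hence equal
  indices. The subtraction is carried out in the integers.\<close>

lemma line_meet_once:
  assumes "k \<noteq> l" "i < R" "j < R" "line R k i = line R l i'" "line R k j = line R l j'"
    "i' < R" "j' < R"
  shows "i = j"
proof (rule ccontr)
  assume "i \<noteq> j"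
  define a b a' b' where "a = int (k mod (16 * R\<^sup>2))" and "b = int (k div (16 * R\<^sup>2))"
    and "a' = int (l mod (16 * R\<^sup>2))" and "b' = int (l div (16 * R\<^sup>2))"
  have 1: "a + b * i = a' + b' * i" "a + b * j = a' + b' * j"
    using line_eqD[OF assms(2,6,4)] line_eqD[OF assms(3,7,5)]
    unfolding a_def b_def a'_def b'_def of_nat_mult[symmetric] of_nat_add[symmetric]
    by metis+
  then have "(b - b') * (int i - int j) = 0" by (simp add: algebra_simps)
  then have "b = b'" using \<open>i \<noteq> j\<close> by simp
  moreover from this have "a = a'" using 1 by simp
  ultimately have "k mod (16 * R\<^sup>2) = l mod (16 * R\<^sup>2)" "k div (16 * R\<^sup>2) = l div (16 * R\<^sup>2)"
    unfolding a_def b_def a'_def b'_def by simp_all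
  then have "k = l" using div_mult_mod_eq[of k "16 * R\<^sup>2"] div_mult_mod_eq[of l "16 * R\<^sup>2"] by argo
  then show False using assms(1) by simp
qed

section \<open>Iterated substitution with doubling word length\<close>

text \<open>With \<open>R = 2 ^ (n + 2)\<close>, stage \<open>n\<close> is meant for indices below
  \<open>32 * R ^ 3\<close>. These are the letters of lines over \<open>{0..<R}\<close>, and such
  lines supply the \<open>32 * (2 * R) ^ 3\<close> words of the next stage.\<close>

primrec sep_tree :: "nat \<Rightarrow> nat \<Rightarrow> tree" where
  "sep_tree 0 = Leaf"
| "sep_tree (Suc n) = (\<lambda>k. subst (sep_tree n) (perfect (n + 2) (line (2 ^ (n + 2)) k)))"

lemma labels_line:
  assumes "k < 32 * (2 ^ (n + 3)) ^ 3"
  shows "labels (perfect (n + 2) (line (2 ^ (n + 2)) k)) \<subseteq> {..<32 * (2 ^ (n + 2)) ^ 3}"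
proof -
  have "(2::nat) ^ (n + 3) = 2 * 2 ^ (n + 2)" by (simp add: power_add)
  then have "k < 32 * (2 * 2 ^ (n + 2)) ^ 3" using assms by (simp only:)
  then show ?thesis unfolding labels_perfect using line_less by blast
qed

lemma Suc_add_2: "Suc n + 2 = n + 3"
  by simp

text \<open>All stages grow from the same \<open>2048 = 32 * 4 ^ 3\<close> leaves, so that one
  finite set generates every tree used.\<close>

lemma labels_sep_tree:
  "k < 32 * (2 ^ (n + 2)) ^ 3 \<Longrightarrow> labels (sep_tree n k) \<subseteq> {..<2048}"
proof (induction n arbitrary: k)
  case (Suc n)
  have "labels (perfect (n + 2) (line (2 ^ (n + 2)) k)) \<subseteq> {..<32 * (2 ^ (n + 2)) ^ 3}"
    using labels_line Suc.prems by (simp only: Suc_add_2)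
  then show ?case
    unfolding sep_tree.simps labels_subst by (intro UN_least Suc.IH) (use lessThan_iff in blast)
qed simp

lemma separated_family_antimono:
  "separated_family s N c D \<Longrightarrow> c' \<le> c \<Longrightarrow> separated_family s N c' D"
  unfolding separated_family_def by (meson order_trans)

text \<open>The constant starts at 1 and is multiplied by \<open>1 - 1 / 2 ^ (n + 2)\<close> at step
  \<open>n\<close>. As it never exceeds 1, the loss is at most \<open>1 / 2 ^ (n + 2)\<close>, which
  is the decrease of \<open>1 / 2 ^ (n + 1)\<close> to its half. Two words share at most one of
  their \<open>2 ^ (n + 2)\<close> letters because lines meet at most once.\<close>

lemma sep_tree_separated:
  "\<exists>D. separated_family (sep_tree n) (32 * (2 ^ (n + 2)) ^ 3) (1 / 2 + 1 / 2 ^ (n + 1)) D"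
proof (induction n)
  case 0
  have "separated_family Leaf N 1 (range (\<lambda>i. (Leaf i, Some i)))" for N
    unfolding separated_family_def by (auto split: if_splits)
  then show ?case by auto
next
  case (Suc n)
  let ?R = "2 ^ (n + 2) :: nat"
  let ?c = "1 / 2 + 1 / 2 ^ (n + 1) :: real"
  obtain D where D: "separated_family (sep_tree n) (32 * ?R ^ 3) ?c D" using Suc by blast
  have "\<exists>D'. separated_family (\<lambda>k. subst (sep_tree n) (perfect (n + 2) (line ?R k)))
      (32 * (2 ^ (n + 3)) ^ 3) (?c * (1 - 1 / 2 ^ (n + 2))) D'"
  proof (rule separated_family_step[OF D])
    fix k i :: nat
    show "weight {i} (perfect (n + 2) (line ?R k)) \<le> 1 / 2 ^ (n + 2)"
      by (rule weight_perfect_le) (use line_eqD[of _ ?R _ k k] in auto)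
  next
    fix k l :: nat
    assume "k \<noteq> l"
    show "weight (labels (perfect (n + 2) (line ?R k))) (perfect (n + 2) (line ?R l)) \<le> 1 / 2 ^ (n + 2)"
    proof (rule weight_perfect_le)
      fix i j assume "i < ?R" "j < ?R" "line ?R l i \<in> labels (perfect (n + 2) (line ?R k))"
        "line ?R l j \<in> labels (perfect (n + 2) (line ?R k))"
      then show "i = j" unfolding labels_perfect
        using line_meet_once[of l k i ?R j] \<open>k \<noteq> l\<close> by auto
    qed
  qed (use labels_line in auto)
  moreover have "1 / 2 + 1 / 2 ^ (Suc n + 1) \<le> ?c * (1 - 1 / 2 ^ (n + 2))"
  proof -
    have "?c \<le> 1" using power_increasing[of 1 "n + 1" "2::real"] by (simp add: field_simps)
    then have "?c * (1 / 2 ^ (n + 2)) \<le> 1 * (1 / 2 ^ (n + 2))" by (rule mult_right_mono) simp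
    moreover have "(1 / 2 ^ (n + 1) :: real) = 2 * (1 / 2 ^ (n + 2))" by simp
    ultimately show ?thesis by (simp add: algebra_simps)
  qed
  ultimately show ?case
    unfolding sep_tree.simps Suc_add_2 using separated_family_antimono by blast
qed

lemma sep_tree_tdist:
  assumes "k < 32 * (2 ^ (n + 2)) ^ 3" "l < 32 * (2 ^ (n + 2)) ^ 3" "k \<noteq> l"
  shows "1 / 2 \<le> tdist (sep_tree n k) (sep_tree n l)"
proof -
  obtain D where "separated_family (sep_tree n) (32 * (2 ^ (n + 2)) ^ 3) (1 / 2 + 1 / 2 ^ (n + 1)) D"
    using sep_tree_separated by blast
  then have "1 / 2 + 1 / 2 ^ (n + 1) \<le> tdist (sep_tree n k) (sep_tree n l)"
    using assms unfolding separated_family_def by blast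
  moreover have "(0::real) \<le> 1 / 2 ^ (n + 1)" by simp
  ultimately show ?thesis by linarith
qed

section \<open>Conical midpoint maps\<close>

text \<open>That \<open>m x y\<close> is a midpoint follows from idempotence, by comparing it with
  \<open>m x x = x\<close> and \<open>m y y = y\<close>.\<close>

definition conical_midpoint :: "'a::metric_space set \<Rightarrow> ('a \<Rightarrow> 'a \<Rightarrow> 'a) \<Rightarrow> bool" where
  "conical_midpoint S m \<longleftrightarrow>
     (\<forall>x\<in>S. \<forall>y\<in>S. m x y \<in> S) \<and> (\<forall>x\<in>S. m x x = x) \<and>
     (\<forall>x\<in>S. \<forall>y\<in>S. \<forall>x'\<in>S. \<forall>y'\<in>S. dist (m x y) (m x' y') \<le> (dist x x' + dist y y') / 2)"

text \<open>The conical inequality makes \<open>m\<close> uniformly continuous, so it extends to the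
  closure, and its properties pass to limits.\<close>

lemma conical_midpoint_closure:
  fixes S :: "'a::complete_space set"
  assumes "conical_midpoint S m"
  obtains m' where "conical_midpoint (closure S) m'" "\<And>x y. x \<in> S \<Longrightarrow> y \<in> S \<Longrightarrow> m' x y = m x y"
proof -
  have m_in: "m x y \<in> S" if "x \<in> S" "y \<in> S" for x y
    using assms that unfolding conical_midpoint_def by blast
  have idem: "m x x = x" if "x \<in> S" for x
    using assms that unfolding conical_midpoint_def by blast
  have con: "dist (m x y) (m x' y') \<le> (dist x x' + dist y y') / 2"
    if "x \<in> S" "y \<in> S" "x' \<in> S" "y' \<in> S" for x y x' y'
    using assms that unfolding conical_midpoint_def by blast
  have uc: "uniformly_continuous_on (S \<times> S) (\<lambda>p. m (fst p) (snd p))"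
    unfolding uniformly_continuous_on_def
  proof (intro allI impI)
    fix e :: real assume "e > 0"
    have "dist (m (fst q) (snd q)) (m (fst p) (snd p)) < e"
      if "p \<in> S \<times> S" "q \<in> S \<times> S" "dist q p < e" for p q
      using con[of "fst q" "snd q" "fst p" "snd p"] dist_fst_le[of q p] dist_snd_le[of q p] that
      by (auto simp: mem_Times_iff)
    then show "\<exists>d>0. \<forall>p\<in>S \<times> S. \<forall>q\<in>S \<times> S. dist q p < d \<longrightarrow>
        dist (m (fst q) (snd q)) (m (fst p) (snd p)) < e"
      using \<open>e > 0\<close> by blast
  qed
  obtain g where g: "uniformly_continuous_on (closure (S \<times> S)) g"
    "\<And>p. p \<in> S \<times> S \<Longrightarrow> m (fst p) (snd p) = g p"
    by (rule uniformly_continuous_on_extension_on_closure[OF uc]) (rule that)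
  have cont: "continuous_on (closure S \<times> closure S) g"
    using uniformly_continuous_imp_continuous[OF g(1)] by (simp add: closure_Times)
  define m' where "m' x y = g (x, y)" for x y
  have m': "m' x y = m x y" if "x \<in> S" "y \<in> S" for x y
    using g(2)[of "(x, y)"] that by (simp add: m'_def)
  have lim: "(\<lambda>n. m (u n) (v n)) \<longlonglongrightarrow> m' x y"
    if "\<And>n. u n \<in> S" "\<And>n. v n \<in> S" "u \<longlonglongrightarrow> x" "v \<longlonglongrightarrow> y" for u v x y
  proof -
    have "x \<in> closure S" "y \<in> closure S" unfolding closure_sequential using that by auto
    then have "(\<lambda>n. g (u n, v n)) \<longlonglongrightarrow> g (x, y)"
      using that closure_subset[of S]
      by (intro continuous_on_tendsto_compose[OF cont] tendsto_Pair) (auto intro!: always_eventually)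
    then show ?thesis using m' that(1,2) by (simp add: m'_def)
  qed
  \<comment> \<open>One approximating sequence is fixed per point, so that both arguments of
    \<open>m' x x\<close> are approximated by the same sequence and idempotence applies
    termwise.\<close>
  have "\<forall>x\<in>closure S. \<exists>u. (\<forall>n. u n \<in> S) \<and> u \<longlonglongrightarrow> x"
    by (intro ballI) (simp only: closure_sequential)
  from bchoice[OF this] obtain U
    where U: "\<And>x n. x \<in> closure S \<Longrightarrow> U x n \<in> S" "\<And>x. x \<in> closure S \<Longrightarrow> U x \<longlonglongrightarrow> x"
    by blast
  have "conical_midpoint (closure S) m'"
    unfolding conical_midpoint_def
  proof (intro conjI ballI)
    fix x y assume "x \<in> closure S" "y \<in> closure S"
    then have "(\<lambda>n. m (U x n) (U y n)) \<longlonglongrightarrow> m' x y" "\<And>n. m (U x n) (U y n) \<in> S"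
      using lim[of "U x" "U y"] m_in U by auto
    then show "m' x y \<in> closure S" unfolding closure_sequential by (intro exI conjI allI)
  next
    fix x assume "x \<in> closure S"
    then have "U x \<longlonglongrightarrow> m' x x" "U x \<longlonglongrightarrow> x" using lim[of "U x" "U x" x x] idem U by auto
    then show "m' x x = x" by (rule LIMSEQ_unique)
  next
    fix x y x' y' assume *: "x \<in> closure S" "y \<in> closure S" "x' \<in> closure S" "y' \<in> closure S"
    show "dist (m' x y) (m' x' y') \<le> (dist x x' + dist y y') / 2"
    proof (rule LIMSEQ_le)
      show "(\<lambda>n. dist (m (U x n) (U y n)) (m (U x' n) (U y' n))) \<longlonglongrightarrow> dist (m' x y) (m' x' y')"
        by (intro tendsto_dist lim U *)
      show "(\<lambda>n. (dist (U x n) (U x' n) + dist (U y n) (U y' n)) / 2) \<longlonglongrightarrow> (dist x x' + dist y y') / 2"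
        by (intro tendsto_intros U *) auto
      show "\<exists>N. \<forall>n\<ge>N. dist (m (U x n) (U y n)) (m (U x' n) (U y' n)) \<le>
          (dist (U x n) (U x' n) + dist (U y n) (U y' n)) / 2"
        by (intro exI allI impI con U *)
    qed
  qed
  then show ?thesis using that m' by blast
qed

text \<open>The bisection path is the left end point after \<open>n\<close> bisections guided by the binary
  digits of \<open>t\<close>, and the dyadic floor its parameter.\<close>

primrec bisection_path :: "('a \<Rightarrow> 'a \<Rightarrow> 'a) \<Rightarrow> nat \<Rightarrow> 'a \<Rightarrow> 'a \<Rightarrow> real \<Rightarrow> 'a" where
  "bisection_path m 0 x y t = x"
| "bisection_path m (Suc n) x y t =
     (if t < 1/2 then bisection_path m n x (m x y) (2 * t)
      else bisection_path m n (m x y) y (2 * t - 1))"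

primrec dyadic_floor :: "nat \<Rightarrow> real \<Rightarrow> real" where
  "dyadic_floor 0 t = 0"
| "dyadic_floor (Suc n) t =
     (if t < 1/2 then dyadic_floor n (2 * t) / 2 else (1 + dyadic_floor n (2 * t - 1)) / 2)"

lemma dyadic_floor_bounds:
  assumes "t \<in> {0..1}"
  shows "dyadic_floor n t \<le> t \<and> t \<le> dyadic_floor n t + 1 / 2 ^ n \<and> 0 \<le> dyadic_floor n t"
  using assms
proof (induction n arbitrary: t)
  case (Suc n)
  show ?case
  proof (cases "t < 1/2")
    case True
    then show ?thesis using Suc.IH[of "2 * t"] Suc.prems by auto
  next
    case False
    then show ?thesis using Suc.IH[of "2 * t - 1"] Suc.prems by (auto simp: field_simps)
  qed
qed simp

lemma dyadic_floor_mono: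
  assumes "s \<in> {0..1}" "t \<in> {0..1}" "s \<le> t"
  shows "dyadic_floor n s \<le> dyadic_floor n t"
  using assms
proof (induction n arbitrary: s t)
  case (Suc n)
  consider "t < 1/2" | "s < 1/2" "\<not> t < 1/2" | "\<not> s < 1/2" by linarith
  then show ?case
  proof cases
    case 1
    then show ?thesis using Suc.IH[of "2 * s" "2 * t"] Suc.prems by auto
  next
    case 2
    then have "dyadic_floor n (2 * s) \<le> 1" "0 \<le> dyadic_floor n (2 * t - 1)"
      using dyadic_floor_bounds[of "2 * s" n] dyadic_floor_bounds[of "2 * t - 1" n] Suc.prems by auto
    then show ?thesis using 2 by simp
  next
    case 3
    then show ?thesis using Suc.IH[of "2 * s - 1" "2 * t - 1"] Suc.prems by auto
  qed
qed simp

lemma dyadic_floor_tendsto: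
  assumes "t \<in> {0..1}"
  shows "(\<lambda>n. dyadic_floor n t) \<longlonglongrightarrow> t"
proof (rule tendsto_sandwich)
  show "\<forall>\<^sub>F n in sequentially. t - 1 / 2 ^ n \<le> dyadic_floor n t"
    using dyadic_floor_bounds[OF assms] by (simp add: algebra_simps)
  show "\<forall>\<^sub>F n in sequentially. dyadic_floor n t \<le> t"
    using dyadic_floor_bounds[OF assms] by simp
  have "(\<lambda>n. t - (1 / 2) ^ n) \<longlonglongrightarrow> t - 0"
    by (intro tendsto_diff tendsto_const LIMSEQ_realpow_zero) auto
  then show "(\<lambda>n. t - 1 / 2 ^ n) \<longlonglongrightarrow> t" by (simp add: power_one_over)
qed simp

context
  fixes S :: "'a::metric_space set" and m
  assumes mid: "conical_midpoint S m"
begin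

lemma mid_in: "x \<in> S \<Longrightarrow> y \<in> S \<Longrightarrow> m x y \<in> S"
  using mid unfolding conical_midpoint_def by blast

lemma mid_idem: "x \<in> S \<Longrightarrow> m x x = x"
  using mid unfolding conical_midpoint_def by blast

lemma mid_conical:
  "x \<in> S \<Longrightarrow> y \<in> S \<Longrightarrow> x' \<in> S \<Longrightarrow> y' \<in> S \<Longrightarrow> dist (m x y) (m x' y') \<le> (dist x x' + dist y y') / 2"
  using mid unfolding conical_midpoint_def by blast

lemma mid_dist_left: "x \<in> S \<Longrightarrow> y \<in> S \<Longrightarrow> dist x (m x y) \<le> dist x y / 2"
  using mid_conical[of x x x y] mid_idem by simp

lemma mid_dist_right: "x \<in> S \<Longrightarrow> y \<in> S \<Longrightarrow> dist (m x y) y \<le> dist x y / 2"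
  using mid_conical[of x y y y] mid_idem by simp

lemma bisection_path_in:
  "x \<in> S \<Longrightarrow> y \<in> S \<Longrightarrow> bisection_path m n x y t \<in> S"
  by (induction n arbitrary: x y t) (auto simp: mid_in)

lemma bisection_path_idem: "x \<in> S \<Longrightarrow> bisection_path m n x x t = x"
  by (induction n arbitrary: t) (auto simp: mid_idem)

lemma bisection_path_0: "x \<in> S \<Longrightarrow> y \<in> S \<Longrightarrow> bisection_path m n x y 0 = x"
  by (induction n arbitrary: y) (auto simp: mid_in)

text \<open>The midpoint inequality, applied at each bisection, reproduces the recursion of
  \<open>dyadic_floor\<close>, which therefore takes the place of \<open>t\<close> at a finite
  stage.\<close>

lemma bisection_path_conical:
  assumes "x \<in> S" "y \<in> S" "x' \<in> S" "y' \<in> S" "t \<in> {0..1}"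
  shows "dist (bisection_path m n x y t) (bisection_path m n x' y' t) \<le>
     (1 - dyadic_floor n t) * dist x x' + dyadic_floor n t * dist y y'"
  using assms
proof (induction n arbitrary: x y x' y' t)
  case (Suc n)
  note mm = mid_in[OF Suc.prems(1,2)] mid_in[OF Suc.prems(3,4)] mid_conical[OF Suc.prems(1-4)]
  show ?case
  proof (cases "t < 1/2")
    case True
    then have t: "2 * t \<in> {0..1}" using Suc.prems(5) by auto
    let ?k = "dyadic_floor n (2 * t)"
    have "?k * dist (m x y) (m x' y') \<le> ?k * ((dist x x' + dist y y') / 2)"
      using mm(3) dyadic_floor_bounds[OF t] by (intro mult_left_mono) auto
    then show ?thesis
      using Suc.IH[OF Suc.prems(1) mm(1) Suc.prems(3) mm(2) t] True by (simp add: field_simps)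
  next
    case False
    then have t: "2 * t - 1 \<in> {0..1}" using Suc.prems(5) by auto
    let ?k = "dyadic_floor n (2 * t - 1)"
    have "?k \<le> 1" using dyadic_floor_bounds[OF t, of n] t by auto
    then have "(1 - ?k) * dist (m x y) (m x' y') \<le> (1 - ?k) * ((dist x x' + dist y y') / 2)"
      using mm(3) by (intro mult_left_mono) auto
    then show ?thesis
      using Suc.IH[OF mm(1) Suc.prems(2) mm(2) Suc.prems(4) t] False by (simp add: field_simps)
  qed
qed simp

lemma bisection_path_dist_left:
  assumes "x \<in> S" "y \<in> S" "t \<in> {0..1}"
  shows "dist x (bisection_path m n x y t) \<le> dyadic_floor n t * dist x y"
  using bisection_path_conical[of x x x y t n] assms bisection_path_idem by simp

lemma bisection_path_dist_right:
  assumes "x \<in> S" "y \<in> S" "t \<in> {0..1}"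
  shows "dist (bisection_path m n x y t) y \<le> (1 - dyadic_floor n t) * dist x y"
  using bisection_path_conical[of x y y y t n] assms bisection_path_idem by simp

text \<open>Parameters in the same half are rescaled; parameters in different halves are compared
  through the midpoint. Equality is obtained only in the limit.\<close>

lemma bisection_path_lipschitz:
  assumes "x \<in> S" "y \<in> S" "s \<in> {0..1}" "t \<in> {0..1}" "s \<le> t"
  shows "dist (bisection_path m n x y s) (bisection_path m n x y t) \<le>
     (dyadic_floor n t - dyadic_floor n s) * dist x y"
  using assms
proof (induction n arbitrary: x y s t)
  case (Suc n)
  note mm = mid_in[OF Suc.prems(1,2)] mid_dist_left[OF Suc.prems(1,2)] mid_dist_right[OF Suc.prems(1,2)]
  let ?k = "dyadic_floor n"
  consider "t < 1/2" | "s < 1/2" "\<not> t < 1/2" | "\<not> s < 1/2" by linarith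
  then show ?case
  proof cases
    case 1
    then have st: "2 * s \<in> {0..1}" "2 * t \<in> {0..1}" "2 * s \<le> 2 * t" using Suc.prems by auto
    note IH = Suc.IH[OF Suc.prems(1) mm(1) st]
    have "(?k (2 * t) - ?k (2 * s)) * dist x (m x y) \<le> (?k (2 * t) - ?k (2 * s)) * (dist x y / 2)"
      using mm(2) dyadic_floor_mono[OF st] by (intro mult_left_mono) auto
    then show ?thesis using IH 1 Suc.prems(5) by (simp add: field_simps)
  next
    case 2
    then have st: "2 * s \<in> {0..1}" "2 * t - 1 \<in> {0..1}" using Suc.prems by auto
    have "dist (bisection_path m n x (m x y) (2 * s)) (m x y) \<le> (1 - ?k (2 * s)) * dist x (m x y)"
      by (rule bisection_path_dist_right) (use Suc.prems mm st in auto)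
    also have "\<dots> \<le> (1 - ?k (2 * s)) * (dist x y / 2)"
      using mm(2) dyadic_floor_bounds[OF st(1), of n] st by (intro mult_left_mono) auto
    finally have a: "dist (bisection_path m n x (m x y) (2 * s)) (m x y) \<le> (1 - ?k (2 * s)) * (dist x y / 2)" .
    have "dist (m x y) (bisection_path m n (m x y) y (2 * t - 1)) \<le> ?k (2 * t - 1) * dist (m x y) y"
      by (rule bisection_path_dist_left) (use Suc.prems mm st in auto)
    also have "\<dots> \<le> ?k (2 * t - 1) * (dist x y / 2)"
      using mm(3) dyadic_floor_bounds[OF st(2), of n] by (intro mult_left_mono) auto
    finally have b: "dist (m x y) (bisection_path m n (m x y) y (2 * t - 1)) \<le> ?k (2 * t - 1) * (dist x y / 2)" .
    have "dist (bisection_path m n x (m x y) (2 * s)) (bisection_path m n (m x y) y (2 * t - 1)) \<le>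
        (1 - ?k (2 * s)) * (dist x y / 2) + ?k (2 * t - 1) * (dist x y / 2)"
      using a b dist_triangle[of "bisection_path m n x (m x y) (2 * s)"
          "bisection_path m n (m x y) y (2 * t - 1)" "m x y"] by linarith
    then show ?thesis using 2 by (simp add: field_simps)
  next
    case 3
    then have st: "2 * s - 1 \<in> {0..1}" "2 * t - 1 \<in> {0..1}" "2 * s - 1 \<le> 2 * t - 1"
      using Suc.prems by auto
    note IH = Suc.IH[OF mm(1) Suc.prems(2) st]
    have "(?k (2 * t - 1) - ?k (2 * s - 1)) * dist (m x y) y \<le>
        (?k (2 * t - 1) - ?k (2 * s - 1)) * (dist x y / 2)"
      using mm(3) dyadic_floor_mono[OF st] by (intro mult_left_mono) auto
    then show ?thesis using IH 3 Suc.prems(5) by (simp add: field_simps)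
  qed
qed simp

text \<open>A further bisection either keeps the left end point or moves it to the midpoint of a
  segment of length at most \<open>dist x y / 2 ^ n\<close>.\<close>

lemma bisection_path_Suc_dist:
  assumes "x \<in> S" "y \<in> S"
  shows "dist (bisection_path m n x y t) (bisection_path m (Suc n) x y t) \<le> dist x y / 2 ^ Suc n"
  using assms
proof (induction n arbitrary: x y t)
  case 0
  then show ?case using mid_dist_left by simp
next
  case (Suc n)
  note mm = mid_in[OF Suc.prems] mid_dist_left[OF Suc.prems] mid_dist_right[OF Suc.prems]
  have half: "a / 2 ^ Suc n \<le> dist x y / 2 ^ Suc (Suc n)" if "a \<le> dist x y / 2" for a
    using divide_right_mono[OF that, of "2 ^ Suc n"] by simp
  show ?case
    using Suc.IH[OF Suc.prems(1) mm(1), of "2 * t"] Suc.IH[OF mm(1) Suc.prems(2), of "2 * t - 1"]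
      half[OF mm(2)] half[OF mm(3)]
    unfolding bisection_path.simps(2)[of m "Suc n"] bisection_path.simps(2)[of m n x y]
    by (cases "t < 1/2") (simp_all del: bisection_path.simps(2))
qed

lemma bisection_path_convergent:
  assumes "complete S" "x \<in> S" "y \<in> S"
  shows "\<exists>l\<in>S. (\<lambda>n. bisection_path m n x y t) \<longlonglongrightarrow> l"
proof -
  let ?u = "\<lambda>n. bisection_path m n x y t"
  \<comment> \<open>The geometric sum is kept in closed form so that the induction on
    \<open>k\<close> telescopes.\<close>
  have *: "dist (?u n) (?u (n + k)) \<le> dist x y * (1 / 2 ^ n - 1 / 2 ^ (n + k))" for n k
  proof (induction k)
    case (Suc k)
    have "dist (?u n) (?u (n + Suc k)) \<le> dist (?u n) (?u (n + k)) + dist (?u (n + k)) (?u (Suc (n + k)))"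
      unfolding add_Suc_right by (rule dist_triangle)
    also have "\<dots> \<le> dist x y * (1 / 2 ^ n - 1 / 2 ^ (n + k)) + dist x y / 2 ^ Suc (n + k)"
      using Suc bisection_path_Suc_dist[OF assms(2,3), of "n + k" t] by (rule add_mono)
    also have "\<dots> = dist x y * (1 / 2 ^ n - 1 / 2 ^ (n + Suc k))"
      by (simp add: right_diff_distrib)
    finally show ?case .
  qed simp
  have bound: "dist (?u n) (?u k) \<le> dist x y / 2 ^ n" if "n \<le> k" for n k
  proof -
    have "dist (?u n) (?u k) \<le> dist x y * (1 / 2 ^ n - 1 / 2 ^ k)" using *[of n "k - n"] that by simp
    also have "\<dots> \<le> dist x y * (1 / 2 ^ n)" by (intro mult_left_mono) auto
    finally show ?thesis by simp
  qed
  have "(\<lambda>n. dist x y * (1 / 2) ^ n) \<longlonglongrightarrow> dist x y * 0"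
    by (intro tendsto_mult tendsto_const LIMSEQ_realpow_zero) auto
  then have lim: "(\<lambda>n. dist x y / 2 ^ n) \<longlonglongrightarrow> 0" by (simp add: power_one_over)
  have "Cauchy ?u"
  proof (rule metric_CauchyI)
    fix e :: real assume "e > 0"
    then have "\<forall>\<^sub>F n in sequentially. dist x y / 2 ^ n < e / 2"
      by (intro order_tendstoD(2)[OF lim]) simp
    then obtain N where N: "dist x y / 2 ^ N < e / 2"
      using eventually_happens'[OF sequentially_bot] by blast
    have "dist (?u i) (?u j) < e" if "N \<le> i" "N \<le> j" for i j
      using bound[OF that(1)] bound[OF that(2)] N dist_triangle3[of "?u i" "?u j" "?u N"] by linarith
    then show "\<exists>M. \<forall>i\<ge>M. \<forall>j\<ge>M. dist (?u i) (?u j) < e" by blast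
  qed
  moreover have "\<forall>n. ?u n \<in> S" using bisection_path_in[OF assms(2,3)] by simp
  ultimately show ?thesis using assms(1) unfolding complete_def by simp
qed

lemma conical_midpoint_bicombing:
  assumes "complete S"
  obtains \<sigma> where
    "\<And>x y t. x \<in> S \<Longrightarrow> y \<in> S \<Longrightarrow> \<sigma> x y t \<in> S"
    "\<And>x y. x \<in> S \<Longrightarrow> y \<in> S \<Longrightarrow> \<sigma> x y 0 = x"
    "\<And>x y. x \<in> S \<Longrightarrow> y \<in> S \<Longrightarrow> \<sigma> x y 1 = y"
    "\<And>x y. x \<in> S \<Longrightarrow> y \<in> S \<Longrightarrow> \<sigma> x y (1/2) = m x y"
    "\<And>x y s t. x \<in> S \<Longrightarrow> y \<in> S \<Longrightarrow> s \<in> {0..1} \<Longrightarrow> t \<in> {0..1} \<Longrightarrow>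
       dist (\<sigma> x y s) (\<sigma> x y t) = \<bar>s - t\<bar> * dist x y"
    "\<And>x y x' y' t. x \<in> S \<Longrightarrow> y \<in> S \<Longrightarrow> x' \<in> S \<Longrightarrow> y' \<in> S \<Longrightarrow> t \<in> {0..1} \<Longrightarrow>
       dist (\<sigma> x y t) (\<sigma> x' y' t) \<le> (1 - t) * dist x x' + t * dist y y'"
proof -
  define \<sigma> where "\<sigma> x y t = (SOME l. l \<in> S \<and> (\<lambda>n. bisection_path m n x y t) \<longlonglongrightarrow> l)" for x y t
  have "\<sigma> x y t \<in> S \<and> (\<lambda>n. bisection_path m n x y t) \<longlonglongrightarrow> \<sigma> x y t"
    if "x \<in> S" "y \<in> S" for x y t
    unfolding \<sigma>_def by (rule someI_ex) (use bisection_path_convergent[OF assms that] in blast)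
  then have in_S: "\<sigma> x y t \<in> S" and lim: "(\<lambda>n. bisection_path m n x y t) \<longlonglongrightarrow> \<sigma> x y t"
    if "x \<in> S" "y \<in> S" for x y t
    using that by blast+
  have zero: "\<sigma> x y 0 = x" if "x \<in> S" "y \<in> S" for x y
    using lim[OF that, of 0] bisection_path_0[OF that] by (simp add: LIMSEQ_const_iff)
  have half: "\<sigma> x y (1/2) = m x y" if "x \<in> S" "y \<in> S" for x y
  proof -
    \<comment> \<open>At \<open>1/2\<close> the first bisection takes the right half with remaining
      parameter 0, and the path stays at its left end point \<open>m x y\<close>.\<close>
    have "bisection_path m (Suc n) x y (1/2) = m x y" for n
      using bisection_path_0 mid_in that by simp
    then show ?thesis using LIMSEQ_Suc[OF lim[OF that, of "1/2"]]
      by (simp only: LIMSEQ_const_iff)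
  qed
  have con: "dist (\<sigma> x y t) (\<sigma> x' y' t) \<le> (1 - t) * dist x x' + t * dist y y'"
    if "x \<in> S" "y \<in> S" "x' \<in> S" "y' \<in> S" "t \<in> {0..1}" for x y x' y' t
  proof (rule LIMSEQ_le)
    show "(\<lambda>n. dist (bisection_path m n x y t) (bisection_path m n x' y' t)) \<longlonglongrightarrow> dist (\<sigma> x y t) (\<sigma> x' y' t)"
      by (intro tendsto_dist lim that)
    show "(\<lambda>n. (1 - dyadic_floor n t) * dist x x' + dyadic_floor n t * dist y y')
        \<longlonglongrightarrow> (1 - t) * dist x x' + t * dist y y'"
      by (intro tendsto_intros dyadic_floor_tendsto that)
    show "\<exists>N. \<forall>n\<ge>N. dist (bisection_path m n x y t) (bisection_path m n x' y' t) \<le>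
        (1 - dyadic_floor n t) * dist x x' + dyadic_floor n t * dist y y'"
      by (intro exI allI impI bisection_path_conical that)
  qed
  have lip: "dist (\<sigma> x y s) (\<sigma> x y t) \<le> (t - s) * dist x y"
    if "x \<in> S" "y \<in> S" "s \<in> {0..1}" "t \<in> {0..1}" "s \<le> t" for x y s t
  proof (rule LIMSEQ_le)
    show "(\<lambda>n. dist (bisection_path m n x y s) (bisection_path m n x y t)) \<longlonglongrightarrow> dist (\<sigma> x y s) (\<sigma> x y t)"
      by (intro tendsto_dist lim that)
    show "(\<lambda>n. (dyadic_floor n t - dyadic_floor n s) * dist x y) \<longlonglongrightarrow> (t - s) * dist x y"
      by (intro tendsto_intros dyadic_floor_tendsto that)
    show "\<exists>N. \<forall>n\<ge>N. dist (bisection_path m n x y s) (bisection_path m n x y t) \<le>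
        (dyadic_floor n t - dyadic_floor n s) * dist x y"
      by (intro exI allI impI bisection_path_lipschitz that)
  qed
  have idem: "\<sigma> y y t = y" if "y \<in> S" for y t
    using lim[OF that that, of t] bisection_path_idem[OF that] by (simp add: LIMSEQ_const_iff)
  \<comment> \<open>Bisection follows left end points, so the right end is reached by comparison
    with the constant path at \<open>y\<close>.\<close>
  have one: "\<sigma> x y 1 = y" if "x \<in> S" "y \<in> S" for x y
    using con[of x y y y 1] that idem by simp
  have eq: "dist (\<sigma> x y s) (\<sigma> x y t) = (t - s) * dist x y"
    if xy: "x \<in> S" "y \<in> S" and st: "s \<in> {0..1}" "t \<in> {0..1}" "s \<le> t" for x y s t
  proof -
    \<comment> \<open>The upper bounds for the three pieces of the path add up to
      \<open>dist x y\<close>, so the triangle inequality makes the middle one sharp.\<close>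
    have "dist x (\<sigma> x y s) \<le> s * dist x y" "dist (\<sigma> x y t) y \<le> (1 - t) * dist x y"
      using lip[OF xy, of 0 s] lip[OF xy, of t 1] zero[OF xy] one[OF xy] st by auto
    moreover have "dist x y \<le> dist x (\<sigma> x y s) + dist (\<sigma> x y s) (\<sigma> x y t) + dist (\<sigma> x y t) y"
      using dist_triangle[of x y "\<sigma> x y s"] dist_triangle[of "\<sigma> x y s" y "\<sigma> x y t"] by linarith
    ultimately have "(t - s) * dist x y \<le> dist (\<sigma> x y s) (\<sigma> x y t)" by (simp add: algebra_simps)
    then show ?thesis using lip[OF xy st] by linarith
  qed
  have "dist (\<sigma> x y s) (\<sigma> x y t) = \<bar>s - t\<bar> * dist x y"
    if "x \<in> S" "y \<in> S" "s \<in> {0..1}" "t \<in> {0..1}" for x y s t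
    using eq[OF that] eq[OF that(1,2,4,3)] by (cases "s \<le> t") (auto simp: dist_commute)
  with in_S zero one half show ?thesis using con by (rule that)
qed

end

section \<open>The completion of the free algebra\<close>

text \<open>The discrete topology on the index type makes every bounded function continuous. The
  target space is complete, so the closure of the range is the completion of the trees modulo
  distance 0.\<close>

definition kuratowski :: "tree \<Rightarrow> tree discrete \<Rightarrow>\<^sub>C real" where
  "kuratowski w = Bcontfun (\<lambda>i. tdist w (of_discrete i))"

lemma apply_kuratowski: "apply_bcontfun (kuratowski w) i = tdist w (of_discrete i)"
proof -
  have "continuous_on UNIV (\<lambda>i. tdist w (of_discrete i))"
    by (simp add: continuous_on_open_vimage open_discrete)
  then have "(\<lambda>i. tdist w (of_discrete i)) \<in> bcontfun"
    unfolding bcontfun_def bounded_iff using tdist_nonneg tdist_le_1 by (auto intro!: exI[of _ 1])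
  then show ?thesis unfolding kuratowski_def by (simp add: Bcontfun_inverse)
qed

lemma dist_kuratowski: "dist (kuratowski v) (kuratowski w) = tdist v w"
proof (rule antisym)
  show "dist (kuratowski v) (kuratowski w) \<le> tdist v w"
  proof (rule dist_bound)
    fix i
    show "dist (kuratowski v i) (kuratowski w i) \<le> tdist v w"
      using tdist_triangle[of v "of_discrete i" w] tdist_triangle[of w "of_discrete i" v]
      by (simp add: apply_kuratowski dist_real_def tdist_commute[of w v])
  qed
  show "tdist v w \<le> dist (kuratowski v) (kuratowski w)"
    \<comment> \<open>The supremum is bounded below by the value at the index \<open>w\<close>,
      where the second function vanishes.\<close>
    using dist_bounded[of "kuratowski v" "discrete w" "kuratowski w"]
    by (simp add: apply_kuratowski discrete_inverse)
qed

lemma kuratowski_eqI: "tdist v w = 0 \<Longrightarrow> kuratowski v = kuratowski w"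
  using dist_kuratowski by (metis dist_eq_0_iff)

lemma kuratowski_midpoint:
  obtains m where "conical_midpoint (closure (range kuratowski)) m"
    "\<And>v w. m (kuratowski v) (kuratowski w) = kuratowski (Node v w)"
proof -
  \<comment> \<open>Arbitrary representatives may be chosen: by the conical inequality, replacing
    subtrees by trees at distance 0 moves the \<open>Node\<close> by distance 0.\<close>
  define m where "m a b = kuratowski (Node (inv kuratowski a) (inv kuratowski b))" for a b
  have inv: "kuratowski (inv kuratowski (kuratowski v)) = kuratowski v" for v
    by (simp add: f_inv_into_f)
  have zero: "tdist (inv kuratowski (kuratowski v)) v = 0" for v
    using dist_kuratowski[of "inv kuratowski (kuratowski v)" v] inv by simp
  have m: "m (kuratowski v) (kuratowski w) = kuratowski (Node v w)" for v w
    unfolding m_def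
    by (rule kuratowski_eqI) (use tdist_Node_Node zero tdist_nonneg in
      \<open>metis add_0 div_0 order_antisym\<close>)
  have "kuratowski (Node v v) = kuratowski v" for v
    by (rule kuratowski_eqI) (use tdist_Node_left[of v v v] tdist_nonneg[of "Node v v" v] in simp)
  moreover have "dist (kuratowski (Node v w)) (kuratowski (Node v' w')) \<le>
      (dist (kuratowski v) (kuratowski v') + dist (kuratowski w) (kuratowski w')) / 2" for v w v' w'
    unfolding dist_kuratowski by (rule tdist_Node_Node)
  ultimately have mid: "conical_midpoint (range kuratowski) m"
    unfolding conical_midpoint_def by (auto simp: m simp del: le_divide_eq_numeral1)
  obtain m' where "conical_midpoint (closure (range kuratowski)) m'"
    "\<And>x y. x \<in> range kuratowski \<Longrightarrow> y \<in> range kuratowski \<Longrightarrow> m' x y = m x y"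
    by (rule conical_midpoint_closure[OF mid]) (rule that)
  then show ?thesis using that[of m'] m by simp
qed

section \<open>Realization on real sequences and failure of compactness\<close>

theorem theorem1p2:
  shows "\<exists>(X :: (nat \<Rightarrow> real) set) (d :: (nat \<Rightarrow> real) \<Rightarrow> (nat \<Rightarrow> real) \<Rightarrow> real)
           (\<sigma> :: (nat \<Rightarrow> real) \<Rightarrow> (nat \<Rightarrow> real) \<Rightarrow> real \<Rightarrow> (nat \<Rightarrow> real)) (A :: (nat \<Rightarrow> real) set).
           Metric_space X d \<and> Metric_space.mcomplete X d \<and>
           Metric_space.conical_bicombing X d \<sigma> \<and>
           finite A \<and> A \<subseteq> X \<and>
           \<not> compactin (Metric_space.mtopology X d) (Metric_space.closed_sigma_hull X d \<sigma> A)"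
proof -
  obtain m where mid: "conical_midpoint (closure (range kuratowski)) m"
    and m: "\<And>v w. m (kuratowski v) (kuratowski w) = kuratowski (Node v w)"
    by (rule kuratowski_midpoint) (rule that)
  define K where "K = closure (range kuratowski)"
  have K: "complete K" unfolding K_def by (simp add: complete_eq_closed)
  obtain s where s_in: "\<And>x y t. x \<in> K \<Longrightarrow> y \<in> K \<Longrightarrow> s x y t \<in> K"
    and s_0: "\<And>x y. x \<in> K \<Longrightarrow> y \<in> K \<Longrightarrow> s x y 0 = x"
    and s_1: "\<And>x y. x \<in> K \<Longrightarrow> y \<in> K \<Longrightarrow> s x y 1 = y"
    and s_half: "\<And>x y. x \<in> K \<Longrightarrow> y \<in> K \<Longrightarrow> s x y (1/2) = m x y"
    and s_geodesic: "\<And>x y t t'. x \<in> K \<Longrightarrow> y \<in> K \<Longrightarrow> t \<in> {0..1} \<Longrightarrow> t' \<in> {0..1} \<Longrightarrow>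
       dist (s x y t) (s x y t') = \<bar>t - t'\<bar> * dist x y"
    and s_conical: "\<And>x y x' y' t. x \<in> K \<Longrightarrow> y \<in> K \<Longrightarrow> x' \<in> K \<Longrightarrow> y' \<in> K \<Longrightarrow> t \<in> {0..1} \<Longrightarrow>
       dist (s x y t) (s x' y' t) \<le> (1 - t) * dist x x' + t * dist y y'"
    by (rule conical_midpoint_bicombing[OF mid, folded K_def, OF K]) (rule that)
  \<comment> \<open>Trees are countable, so a function on them is coded as a real sequence.
    \<open>\<psi>\<close> decodes it, and the metric and the bicombing are transported along this
    coding.\<close>
  define \<phi> where "\<phi> x n = apply_bcontfun x (discrete (from_nat n))"
    for x :: "tree discrete \<Rightarrow>\<^sub>C real" and n :: nat
  define \<psi> where "\<psi> f = (Bcontfun (\<lambda>i. f (to_nat (of_discrete i))) :: tree discrete \<Rightarrow>\<^sub>C real)"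
    for f :: "nat \<Rightarrow> real"
  have \<psi>\<phi>: "\<psi> (\<phi> x) = x" for x
    by (simp add: \<phi>_def \<psi>_def of_discrete_inverse apply_bcontfun_inverse)
  define X where "X = \<phi> ` K"
  define d where "d f g = dist (\<psi> f) (\<psi> g)" for f g
  define \<sigma> where "\<sigma> f g t = \<phi> (s (\<psi> f) (\<psi> g) t)" for f g t
  define A where "A = (\<lambda>i. \<phi> (kuratowski (Leaf i))) ` {..<2048}"
  have d: "d (\<phi> x) (\<phi> y) = dist x y" for x y
    by (simp add: d_def \<psi>\<phi>)
  have \<sigma>: "\<sigma> (\<phi> x) (\<phi> y) t = \<phi> (s x y t)" for x y t
    by (simp add: \<sigma>_def \<psi>\<phi>)
  have \<phi>_eq_iff: "\<phi> x = \<phi> y \<longleftrightarrow> x = y" for x y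
    by (metis \<psi>\<phi>)
  have "Metric_space X d"
  proof
    show "0 \<le> d f g" "d f g = d g f" for f g
      unfolding d_def by (simp_all add: dist_commute)
    show "d f g = 0 \<longleftrightarrow> f = g" if "f \<in> X" "g \<in> X" for f g
      using that unfolding X_def by (auto simp: d \<phi>_eq_iff)
    show "d f h \<le> d f g + d g h" for f g h
      unfolding d_def by (rule dist_triangle)
  qed
  then interpret Metric_space X d .
  have emb: "kuratowski w \<in> K" for w
    unfolding K_def using closure_subset[of "range kuratowski"] by auto
  have "mcomplete"
    unfolding mcomplete_def
  proof (intro allI impI)
    fix u assume u: "MCauchy u"
    define v where "v n = \<psi> (u n)" for n
    have v: "v n \<in> K" "u n = \<phi> (v n)" for n
    proof -
      have "u n \<in> X" using u unfolding MCauchy_def by blast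
      then show "v n \<in> K" "u n = \<phi> (v n)"
        unfolding X_def v_def by (auto simp: \<psi>\<phi>)
    qed
    have "Cauchy v"
      using u unfolding MCauchy_def Cauchy_def v(2) d by meson
    then obtain l where "l \<in> K" "v \<longlonglongrightarrow> l" using K v(1) unfolding complete_def by blast
    then have "limitin mtopology u (\<phi> l) sequentially"
      unfolding limit_metric_sequentially v(2) d by (auto simp: X_def v(1) lim_sequentially)
    then show "\<exists>x. limitin mtopology u x sequentially" by blast
  qed
  moreover have "conical_bicombing \<sigma>"
  proof -
    have "d (\<sigma> x y t) (\<sigma> x y t') = \<bar>t - t'\<bar> * d (\<sigma> x y 0) (\<sigma> x y 1)"
      if "x \<in> X" "y \<in> X" "t \<in> {0..1}" "t' \<in> {0..1}" for x y t t'
      using that s_geodesic s_0 s_1 unfolding X_def by (auto simp: \<sigma> d)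
    moreover have "\<sigma> x y t \<in> X" "\<sigma> x y 0 = x" "\<sigma> x y 1 = y" if "x \<in> X" "y \<in> X" for x y t
      using that s_in s_0 s_1 unfolding X_def by (auto simp: \<sigma>)
    moreover have "d (\<sigma> x y t) (\<sigma> x' y' t) \<le> (1 - t) * d x x' + t * d y y'"
      if "x \<in> X" "y \<in> X" "x' \<in> X" "y' \<in> X" "t \<in> {0..1}" for x y x' y' t
      using that s_conical unfolding X_def by (auto simp: \<sigma> d)
    ultimately show ?thesis
      unfolding conical_bicombing_def bicombing_def geodesic_def by auto
  qed
  moreover have "finite A" "A \<subseteq> X" using emb by (auto simp: A_def X_def)
  moreover have "\<not> compactin mtopology (closed_sigma_hull \<sigma> A)"
  proof
    \<comment> \<open>At parameter \<open>1/2\<close> the bicombing is \<open>Node\<close>, so a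
      \<sigma>-convex set containing the leaves contains every tree built from them.\<close>
    have hull: "\<phi> (kuratowski w) \<in> closed_sigma_hull \<sigma> A" if "labels w \<subseteq> {..<2048}" for w
      unfolding closed_sigma_hull_def
    proof (rule InterI, clarify)
      fix C assume C: "sigma_convex \<sigma> C" "A \<subseteq> C"
      show "\<phi> (kuratowski w) \<in> C"
        using that
      proof (induction w)
        case (Leaf i)
        then show ?case using C by (auto simp: A_def)
      next
        case (Node p q)
        have "\<phi> (kuratowski (Node p q)) =
            \<sigma> (\<phi> (kuratowski p)) (\<phi> (kuratowski q)) (1/2)"
          using s_half[OF emb emb] m by (simp add: \<sigma>)
        moreover have "\<sigma> (\<phi> (kuratowski p)) (\<phi> (kuratowski q)) (1/2) \<in> C"
          using C(1) Node unfolding sigma_convex_def by (auto simp: image_subset_iff)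
        ultimately show ?case by simp
      qed
    qed
    assume "compactin mtopology (closed_sigma_hull \<sigma> A)"
    then have "mtotally_bounded (closed_sigma_hull \<sigma> A)" by (rule compactin_imp_mtotally_bounded)
    then obtain F where F: "finite F" "closed_sigma_hull \<sigma> A \<subseteq> (\<Union>x\<in>F. mball x (1/4))"
      unfolding mtotally_bounded_def by (meson zero_less_divide_1_iff zero_less_numeral)
    \<comment> \<open>Two points in one ball of radius \<open>1/4\<close> are less than
      \<open>1/2\<close> apart, so each ball holds at most one tree of a stage. Stage
      \<open>n\<close> has more than \<open>n\<close> trees, which contradicts the cover by
      \<open>n\<close> balls.\<close>
    define n where "n = card F"
    define N :: nat where "N = 32 * (2 ^ (n + 2)) ^ 3"
    define e where "e k = \<phi> (kuratowski (sep_tree n k))" for k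
    have "\<exists>x\<in>F. e k \<in> mball x (1/4)" if "k < N" for k
      using F(2) hull[OF labels_sep_tree[of k n]] that unfolding e_def N_def by blast
    then obtain c where c: "\<And>k. k < N \<Longrightarrow> c k \<in> F" "\<And>k. k < N \<Longrightarrow> e k \<in> mball (c k) (1/4)"
      by metis
    have "inj_on c {..<N}"
    proof (rule inj_onI)
      fix k l assume kl: "k \<in> {..<N}" "l \<in> {..<N}" "c k = c l"
      then have "e k \<in> mball (c k) (1/4)" "e l \<in> mball (c k) (1/4)"
        using c(2)[of k] c(2)[of l] by simp_all
      then have "d (e k) (e l) < 1/2"
        using triangle[of "e k" "c k" "e l"] commute by auto
      then show "k = l"
        using sep_tree_tdist[of k n l] kl unfolding e_def d dist_kuratowski N_def by fastforce
    qed
    then have "N \<le> n" using card_inj_on_le[of c "{..<N}" F] F(1) c(1) unfolding n_def by auto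
    moreover have "n < N"
    proof -
      have "n < 2 ^ (n + 2)" using less_exp[of "n + 2"] by linarith
      also have "\<dots> \<le> (2 ^ (n + 2)) ^ 3" by (rule self_le_power) auto
      finally show ?thesis unfolding N_def by linarith
    qed
    ultimately show False by simp
  qed
  ultimately show ?thesis using Metric_space_axioms by blast
qed

end
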